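(* For every $\tau\in\mathbb{H}^2$ set $$u(\tau)=\frac{\eta^4(\tau)\,\eta^4(3\tau/2)\,\eta^4(6\tau)}{\eta^4(\tau/2)\,\eta^4(2\tau)\,\eta^4(3\tau)} .$$ Then $$\{u,\tau\}+\frac{81u^4+108u^3+102u^2+12u+1}{2u^2(u+1)^2(9u+1)^2}\,(u')^2=0 .$$
   Context: $\mathbb{H}^2=\{\tau\in\mathbb{C}\mid \Im\tau>0\}$; $\eta(\tau)=e^{2\pi i\tau/24}\prod_{n\ge1}(1-e^{2\pi i n\tau})$ is the Dedekind eta function and $\eta^k(r\tau)=(\eta(r\tau))^k$. The prime denotes $d/d\tau$, and the Schwarzian derivative of $y=y(x)$ is $\{y,x\}=\frac{y'''}{y'}-\frac32\left(\frac{y''}{y'}\right)^2$, derivatives being taken with respect to $x$. *)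

theory Defs
  imports "HOL-Complex_Analysis.Complex_Analysis"
begin

definition upper_half_plane :: "complex set" where
  "upper_half_plane = {\<tau>. Im \<tau> > 0}"

text \<open>
  The product in the eta function is over \<open>n \<ge> 1\<close>, whence the shift to \<open>Suc n\<close>. The definition is
  meaningful only on the upper half-plane, where the product converges; elsewhere the value is
  irrelevant.
\<close>
definition dedekind_eta :: "complex \<Rightarrow> complex" where
  "dedekind_eta \<tau> =
     exp (2 * of_real pi * \<i> * \<tau> / 24) *
     (\<Prod>n. 1 - exp (2 * of_real pi * \<i> * of_nat (Suc n) * \<tau>))"

definition schwarzian :: "(complex \<Rightarrow> complex) \<Rightarrow> complex \<Rightarrow> complex" where
  "schwarzian y x =
     (deriv ^^ 3) y x / deriv y x - 3 / 2 * ((deriv ^^ 2) y x / deriv y x)\<^sup>2"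

end

theory Submission
  imports Defs "HOL-Library.Nat_Bijection"
begin

text \<open>
  Put \<open>x = exp (i \<pi> \<tau>)\<close>. The eta quotient becomes the function
  \<open>U x = x \<cdot> K(x^3)^4 / K(x)^4\<close> on the unit disc, where
  \<open>K(x) = \<Prod>(1 - x^n) (1 - x^(4n)) / (1 - x^(2n))\<close>. The proof compares
  \<open>U\<close> with its pullback under the isogeny \<open>x \<mapsto> x^3\<close>.
  The functions \<open>K\<close>, \<open>U\<close> and, below, \<open>Y\<close> are called \<open>psi_minus\<close>, \<open>hauptmodul\<close> and \<open>cubic_param\<close>.

  By a theorem of Gauss, \<open>K(x) = \<Sum>(-x)^(j(j+1)/2)\<close> (\<open>psi_minus_sums\<close>). The exponents are \<open>0\<close> or \<open>1\<close>
  modulo \<open>3\<close>, and those that are \<open>1\<close> reproduce \<open>K(x^9)\<close>. Hence \<open>K(x) + x K(x^9)\<close> is a function of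
  \<open>x^3\<close>. Multiplying \<open>K(x) K(\<omega>x) K(\<omega>^2 x)\<close> out with this information, and computing the same
  product from the infinite product, gives the cubic transformation: for \<open>Y = x K(x^9) / K(x)\<close>,
    \<open>U(x) = Y (1 + 3Y + 3Y^2)\<close>  and  \<open>U(x^3) = Y^3 / (1 + 3Y + 3Y^2)\<close>
  (\<open>hauptmodul_conv_param\<close>).

  Write \<open>Q\<close> (\<open>potential\<close>) for the rational coefficient in the claim and \<open>G = {U,x} + Q(U) U'^2\<close>. The quadratic
  differential \<open>Q(u) du^2\<close>, corrected by the Schwarzian derivatives of the two rational maps, has the
  same pullback under both of them (\<open>param_maps_same_pullback\<close>). So the chain rule for the
  Schwarzian derivative relates \<open>G(x)\<close> to \<open>G(x^3)\<close>; for \<open>H(x) = 1/2 - x^2 G(x)\<close> the relation reads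
  \<open>H(x) = 9 H(x^3)\<close>. Now \<open>H\<close> is holomorphic in the disc and \<open>H(0) = 0\<close>, so
  \<open>H(x) = 9^n H(x^(3^n)) \<rightarrow> 0\<close>, that is, \<open>H = 0\<close>. In the variable \<open>\<tau>\<close> this is the claim.

  The holomorphy of \<open>H\<close> needs that \<open>U\<close> omits the values \<open>-1\<close> and \<open>-1/9\<close> and has no critical point.
  The same iteration proves both: by the cubic transformation each of these defects would pass from
  \<open>x\<close> to \<open>x^3\<close>, hence by continuity to \<open>0\<close>, where \<open>U(0) = 0\<close> and \<open>U'(0) = 1\<close>.
\<close>

section \<open>Euler's product\<close>

definition euler_prod :: "complex \<Rightarrow> complex" where
  "euler_prod x = (\<Prod>n. 1 - x ^ Suc n)"

definition euler_part :: "nat \<Rightarrow> complex \<Rightarrow> complex" where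
  "euler_part N x = (\<Prod>k<N. 1 - x ^ Suc k)"

lemma norm_power_less_1: "norm x < 1 \<Longrightarrow> 0 < n \<Longrightarrow> norm (x ^ n) < 1"
  for x :: complex
  by (simp add: norm_power power_less_one_iff)

lemma one_minus_power_nonzero: "norm x < 1 \<Longrightarrow> 0 < n \<Longrightarrow> 1 - x ^ n \<noteq> 0"
  for x :: complex
  using norm_power_less_1[of x n] by auto

lemma convergent_euler_prod:
  assumes "norm x < 1"
  shows "convergent_prod (\<lambda>n. 1 - x ^ Suc n :: complex)"
proof -
  have "summable (\<lambda>n. norm x ^ Suc n)"
    using assms by (subst summable_Suc_iff) (simp add: summable_geometric)
  then show ?thesis
    by (intro abs_convergent_prod_imp_convergent_prod summable_imp_abs_convergent_prod)
       (simp add: norm_power norm_mult)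
qed

lemma euler_part_LIMSEQ:
  assumes "norm x < 1"
  shows "(\<lambda>N. euler_part N x) \<longlonglongrightarrow> euler_prod x"
proof -
  have "(\<lambda>N. euler_part (Suc N) x) \<longlonglongrightarrow> euler_prod x"
    unfolding euler_part_def euler_prod_def lessThan_Suc_atMost
    by (rule convergent_prod_LIMSEQ[OF convergent_euler_prod[OF assms]])
  then show ?thesis
    by (rule LIMSEQ_imp_Suc)
qed

lemma euler_prod_nonzero: "norm x < 1 \<Longrightarrow> euler_prod x \<noteq> 0"
  unfolding euler_prod_def
  by (intro prodinf_nonzero convergent_euler_prod one_minus_power_nonzero) auto

lemma euler_prod_0 [simp]: "euler_prod 0 = 1"
  by (simp add: euler_prod_def)

lemma holomorphic_euler_prod: "euler_prod holomorphic_on ball 0 1"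
proof (rule holomorphic_uniform_sequence)
  show "euler_part n holomorphic_on ball 0 1" for n
    unfolding euler_part_def by (intro holomorphic_intros)
next
  fix x :: complex assume "x \<in> ball 0 1"
  \<comment> \<open>The disc of radius \<open>d\<close> about \<open>x\<close> lies inside the disc of radius \<open>r < 1\<close> about \<open>0\<close>, on which
      the geometric series dominates.\<close>
  define d where "d = (1 - norm x) / 2"
  define r where "r = (1 + norm x) / 2"
  have d: "d > 0" and r: "0 < r" "r < 1"
    using \<open>x \<in> ball 0 1\<close> by (auto simp: d_def r_def add_pos_nonneg)
  have le: "norm y \<le> r" if "y \<in> cball x d" for y
    using that norm_triangle_ineq3[of y x]
    by (simp add: dist_norm norm_minus_commute d_def r_def field_simps)
  have sub: "cball x d \<subseteq> ball 0 1"
    using le r by force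
  have "summable (\<lambda>n. r ^ Suc n)"
    using r by (subst summable_Suc_iff) (simp add: summable_geometric)
  then have "uniformly_convergent_on (cball x d) (\<lambda>N y. \<Sum>n<N. norm ((1 - y ^ Suc n) - 1))"
    by (intro Weierstrass_m_test'[where M = "\<lambda>n. r ^ Suc n"])
       (use r in \<open>auto simp: norm_power norm_mult intro!: mult_mono power_mono le simp del: mem_cball\<close>)
  then have "uniformly_convergent_on (cball x d) (\<lambda>N y. \<Prod>n<N. 1 - y ^ Suc n)"
    by (intro uniformly_convergent_on_prod') (auto intro!: continuous_intros)
  then obtain l where l: "uniform_limit (cball x d) euler_part l sequentially"
    unfolding euler_part_def[abs_def] uniformly_convergent_on_def by blast
  have "l y = euler_prod y" if "y \<in> cball x d" for y
    using tendsto_uniform_limitI[OF l that] euler_part_LIMSEQ[of y] le[OF that] r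
    by (intro LIMSEQ_unique) auto
  then have "uniform_limit (cball x d) euler_part euler_prod sequentially"
    using l by (subst (asm) uniform_limit_cong'[where g = euler_part]) auto
  with d sub show "\<exists>d>0. cball x d \<subseteq> ball 0 1 \<and> uniform_limit (cball x d) euler_part euler_prod sequentially"
    by blast
qed auto

lemma filterlim_mult_const_nat: "0 < (c::nat) \<Longrightarrow> filterlim (\<lambda>n. c * n) sequentially sequentially"
  by (intro filterlim_subseq) (auto simp: strict_mono_def)

text \<open>
  An even exponent \<open>k\<close> contributes \<open>(1 - x^k)^2\<close> to the product of the first two factors on the left,
  an odd one contributes \<open>1 - x^(2k)\<close>; the latter are the factors of the last product that do not
  occur in \<open>euler_part n (x^4)\<close>.
\<close>
lemma euler_part_double:
  "euler_part (2*n) (-x) * euler_part (2*n) x * euler_part n (x^4)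
     = euler_part n (x^2) ^ 2 * euler_part (2*n) (x^2)"
proof (induction n)
  case (Suc n)
  have *: "euler_part (2 * Suc n) y = euler_part (2*n) y * (1 - y ^ (2*n+1)) * (1 - y ^ (2*n+2))" for y
    by (simp add: euler_part_def)
  have **: "euler_part (Suc n) y = euler_part n y * (1 - y ^ (n+1))" for y
    by (simp add: euler_part_def)
  have e: "(x^4)^(n+1) = (x ^ (2*n+2))^2" "(x\<^sup>2)^(n+1) = x ^ (2*n+2)"
      "(x\<^sup>2)^(2*n+1) = (x ^ (2*n+1))^2" "(x\<^sup>2)^(2*n+2) = (x ^ (2*n+2))^2"
    by (simp_all add: power_mult[symmetric] algebra_simps) (simp_all add: power2_eq_square)
  have e': "(-x) ^ (2*n+1) = - (x ^ (2*n+1))" "(-x) ^ (2*n+2) = x ^ (2*n+2)"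
    by simp_all
  define a b where "a = x ^ (2*n+1)" and "b = x ^ (2*n+2)"
  have "euler_part (2 * Suc n) (-x) * euler_part (2 * Suc n) x * euler_part (Suc n) (x^4)
     = (euler_part (2*n) (-x) * euler_part (2*n) x * euler_part n (x^4))
       * ((1 + a) * (1 - b) * (1 - a) * (1 - b) * (1 - b^2))"
    unfolding * ** e e' a_def[symmetric] b_def[symmetric] by (simp add: mult_ac)
  also have "\<dots> = (euler_part n (x^2) * (1 - b)) ^ 2 * (euler_part (2*n) (x^2) * (1 - a^2) * (1 - b^2))"
    unfolding Suc.IH by (simp add: power2_eq_square algebra_simps)
  also have "\<dots> = euler_part (Suc n) (x^2) ^ 2 * euler_part (2 * Suc n) (x^2)"
    unfolding * ** e a_def b_def by simp
  finally show ?case .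
qed (simp add: euler_part_def)

lemma euler_prod_minus:
  assumes x: "norm x < 1"
  shows "euler_prod (-x) * euler_prod x * euler_prod (x^4) = euler_prod (x^2) ^ 3"
proof -
  have sub: "filterlim (\<lambda>n::nat. 2 * n) sequentially sequentially"
    by (rule filterlim_mult_const_nat) simp
  have 1: "(\<lambda>n. euler_part (2*n) (-x) * euler_part (2*n) x * euler_part n (x^4))
      \<longlonglongrightarrow> euler_prod (-x) * euler_prod x * euler_prod (x^4)"
    using x by (intro tendsto_intros filterlim_compose[OF euler_part_LIMSEQ sub] euler_part_LIMSEQ)
       (auto simp: norm_power_less_1)
  have 2: "(\<lambda>n. euler_part n (x^2) ^ 2 * euler_part (2*n) (x^2))
      \<longlonglongrightarrow> euler_prod (x^2) ^ 2 * euler_prod (x^2)"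
    using x by (intro tendsto_intros filterlim_compose[OF euler_part_LIMSEQ sub] euler_part_LIMSEQ)
       (auto simp: norm_power_less_1)
  show ?thesis
    using LIMSEQ_unique[OF 1 2[folded euler_part_double]]
    by (simp add: power3_eq_cube power2_eq_square)
qed

text \<open>
  Over the three cube roots of unity the factors \<open>1 - (\<zeta>x)^k\<close> multiply to \<open>1 - x^(3k)\<close> if \<open>3\<close> does not
  divide \<open>k\<close>, and to \<open>(1 - x^k)^3\<close> otherwise.
\<close>
lemma euler_part_triple:
  assumes w: "1 + w + w^2 = (0::complex)"
  shows "euler_part (3*n) x * euler_part (3*n) (w*x) * euler_part (3*n) (w^2*x) * euler_part n (x^9)
     = euler_part (3*n) (x^3) * euler_part n (x^3) ^ 3"
proof (induction n)
  case (Suc n)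
  have w3: "w ^ 3 = 1" using w by algebra
  have *: "euler_part (3 * Suc n) y
      = euler_part (3*n) y * (1 - y ^ (3*n+1)) * (1 - y ^ (3*n+2)) * (1 - y ^ (3*n+3))" for y
    by (simp add: euler_part_def numeral_3_eq_3)
  have **: "euler_part (Suc n) y = euler_part n y * (1 - y ^ (n+1))" for y
    by (simp add: euler_part_def)
  define a b c where "a = x ^ (3*n+1)" and "b = x ^ (3*n+2)" and "c = x ^ (3*n+3)"
  have wn: "w ^ (3*n) = 1" "(w^2) ^ (3*n) = 1"
    using w3 power_mult[of w 3 n] power_mult[of w 3 "2*n"] power_mult[of w 2 "3*n"]
    by (simp_all add: mult.left_commute)
  have e: "(w*x) ^ (3*n+1) = w * a" "(w*x) ^ (3*n+2) = w^2 * b" "(w*x) ^ (3*n+3) = c"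
      "(w^2*x) ^ (3*n+1) = w^2 * a" "(w^2*x) ^ (3*n+2) = w * b" "(w^2*x) ^ (3*n+3) = c"
    using w3 wn unfolding a_def b_def c_def
    by (simp_all add: power_mult_distrib power_add power2_eq_square power3_eq_cube mult_ac)
  have e': "(x^9)^(n+1) = c^3" "(x^3)^(n+1) = c" "(x^3)^(3*n+1) = a^3" "(x^3)^(3*n+2) = b^3" "(x^3)^(3*n+3) = c^3"
    unfolding a_def b_def c_def by (simp_all flip: power_mult add: algebra_simps) (simp_all add: power_add)
  have cube: "(1 - y) * (1 - w * y) * (1 - w^2 * y) = 1 - y^3" for y
    using w by algebra
  have "euler_part (3 * Suc n) x * euler_part (3 * Suc n) (w*x) * euler_part (3 * Suc n) (w^2*x) * euler_part (Suc n) (x^9)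
     = (euler_part (3*n) x * euler_part (3*n) (w*x) * euler_part (3*n) (w^2*x) * euler_part n (x^9))
       * (((1 - a) * (1 - w * a) * (1 - w^2 * a)) * ((1 - b) * (1 - w * b) * (1 - w^2 * b)) * (1 - c)^3 * (1 - c^3))"
    unfolding * ** e e' a_def[symmetric] b_def[symmetric] c_def[symmetric]
    by (simp add: power3_eq_cube mult_ac)
  also have "\<dots> = (euler_part (3*n) (x^3) * (1 - a^3) * (1 - b^3) * (1 - c^3)) * (euler_part n (x^3) * (1 - c)) ^ 3"
    unfolding Suc.IH cube by (simp add: power_mult_distrib mult_ac)
  also have "\<dots> = euler_part (3 * Suc n) (x^3) * euler_part (Suc n) (x^3) ^ 3"
    unfolding * ** e' by simp
  finally show ?case .
qed (simp add: euler_part_def)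

lemma euler_prod_triple:
  assumes x: "norm x < 1" and w: "1 + w + w^2 = 0" "norm w = 1"
  shows "euler_prod x * euler_prod (w*x) * euler_prod (w^2*x) * euler_prod (x^9) = euler_prod (x^3) ^ 4"
proof -
  have sub: "filterlim (\<lambda>n::nat. 3 * n) sequentially sequentially"
    by (rule filterlim_mult_const_nat) simp
  have 1: "(\<lambda>n. euler_part (3*n) x * euler_part (3*n) (w*x) * euler_part (3*n) (w^2*x) * euler_part n (x^9))
      \<longlonglongrightarrow> euler_prod x * euler_prod (w*x) * euler_prod (w^2*x) * euler_prod (x^9)"
    using x w by (intro tendsto_intros filterlim_compose[OF euler_part_LIMSEQ sub] euler_part_LIMSEQ)
       (auto simp: norm_power_less_1 norm_mult norm_power power_less_one_iff)
  have 2: "(\<lambda>n. euler_part (3*n) (x^3) * euler_part n (x^3) ^ 3)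
      \<longlonglongrightarrow> euler_prod (x^3) * euler_prod (x^3) ^ 3"
    using x by (intro tendsto_intros filterlim_compose[OF euler_part_LIMSEQ sub] euler_part_LIMSEQ)
       (auto simp: norm_power_less_1)
  show ?thesis
    using LIMSEQ_unique[OF 1 2[folded euler_part_triple[OF w(1)]]]
    by (simp add: eval_nat_numeral)
qed

section \<open>Gauss's series with triangular exponents\<close>

text \<open>
  The partial products of the product side of Gauss's identity
  \<open>\<Sum> x^(j(j+1)/2) = \<Prod> (1 - x^(2k)) / (1 - x^(2k-1))\<close>.
\<close>
definition gauss_part :: "nat \<Rightarrow> complex \<Rightarrow> complex" where
  "gauss_part n x = (\<Prod>k<n. (1 - x ^ (2*k+2)) / (1 - x ^ (2*k+1)))"

lemma gauss_part_Suc: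
  "gauss_part (Suc n) x = gauss_part n x * ((1 - x ^ (2*n+2)) / (1 - x ^ (2*n+1)))"
  by (simp add: gauss_part_def)

lemma gauss_part_nonzero: "norm x < 1 \<Longrightarrow> gauss_part n x \<noteq> 0"
  unfolding gauss_part_def using one_minus_power_nonzero[of x "2 * _ + 1"] one_minus_power_nonzero[of x "2 * _ + 2"]
  by (auto simp del: power_Suc)

lemma gauss_part_conv_euler_part:
  assumes "norm x < 1"
  shows "gauss_part n x = euler_part n (x^2) ^ 2 / euler_part (2*n) x"
proof (induction n)
  case (Suc n)
  have cancel: "E^2 / F * (q / p) = (E * q)^2 / (F * p * q)" if "q \<noteq> 0" for E F p q :: complex
    using that by (simp add: power2_eq_square)
  have *: "euler_part (2 * Suc n) x = euler_part (2*n) x * (1 - x ^ (2*n+1)) * (1 - x ^ (2*n+2))"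
    by (simp add: euler_part_def)
  have **: "euler_part (Suc n) (x^2) = euler_part n (x^2) * (1 - x ^ (2*n+2))"
    by (simp add: euler_part_def flip: power_mult power_add)
  have "1 - x ^ (2*n+2) \<noteq> 0"
    using one_minus_power_nonzero[OF assms, of "2*n+2"] by simp
  then show ?case
    unfolding gauss_part_Suc Suc.IH * **
    using cancel[of "1 - x ^ (2*n+2)" "euler_part n (x^2)" "euler_part (2*n) x" "1 - x ^ (2*n+1)"] by blast
qed (simp add: gauss_part_def euler_part_def)

lemma gauss_part_LIMSEQ:
  assumes "norm x < 1"
  shows "(\<lambda>n. gauss_part n x) \<longlonglongrightarrow> euler_prod (x^2) ^ 2 / euler_prod x"
  unfolding gauss_part_conv_euler_part[OF assms]
  using assms filterlim_mult_const_nat[of 2]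
  by (intro tendsto_intros filterlim_compose[OF euler_part_LIMSEQ] euler_part_LIMSEQ euler_prod_nonzero)
     (auto simp: norm_power_less_1)

text \<open>
  The summand on the left is the difference of two consecutive values of the right-hand side, so the
  sum telescopes. This is the induction step of Shanks's identity, truncated at \<open>m\<close>.
\<close>
lemma shanks_step:
  assumes x: "norm x < 1"
  shows "(\<Sum>s<m. gauss_part (Suc n) x / gauss_part s x * x ^ (s * (2*n+3))
              - gauss_part n x / gauss_part s x * x ^ (s * (2*n+1)))
     = gauss_part n x / gauss_part m x * (1 - x ^ (2*m)) * x ^ (m * (2*n+1)) / (1 - x ^ (2*n+1))"
proof (induction m)
  case (Suc m)
  define P Q where "P = gauss_part n x" and "Q = gauss_part m x"
  define a b c where "a = x ^ (2*n+1)" and "b = x ^ (2*m)" and "c = x ^ (m * (2*n+1))"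
  have nz: "1 - a \<noteq> 0" "1 - x * b \<noteq> 0" "1 - x^2 * b \<noteq> 0" "Q \<noteq> 0"
    using one_minus_power_nonzero[OF x, of "2*n+1"] one_minus_power_nonzero[OF x, of "2*m+1"]
      one_minus_power_nonzero[OF x, of "2*m+2"] gauss_part_nonzero[OF x]
    by (auto simp: a_def b_def Q_def power2_eq_square mult_ac)
  have e: "x ^ (m * (2*n+3)) = b * c" "x ^ (Suc m * (2*n+1)) = a * c" "x ^ (2 * Suc m) = x^2 * b"
     "x ^ (2*n+2) = x * a" "x ^ (2*m+2) = x^2 * b" "x ^ (2*m+1) = x * b"
    unfolding a_def b_def c_def by (simp_all flip: power_add power_Suc add: algebra_simps)
  have "P / Q * (1 - b) * c / (1 - a) + (P * ((1 - x * a) / (1 - a)) / Q * (b * c) - P / Q * c)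
      = P / Q * c * ((1 - b) / (1 - a) + (1 - x * a) / (1 - a) * b - 1)"
    by (simp add: divide_inverse algebra_simps)
  also have "(1 - b) / (1 - a) + (1 - x * a) / (1 - a) * b - 1 = (1 - x * b) * a / (1 - a)"
    using nz(1) by (simp add: field_simps)
  also have "P / Q * c * ((1 - x * b) * a / (1 - a))
      = P / (Q * ((1 - x^2 * b) / (1 - x * b))) * (1 - x^2 * b) * (a * c) / (1 - a)"
    using nz by simp
  finally show ?case
    unfolding sum.lessThan_Suc Suc.IH
    unfolding gauss_part_Suc e P_def[symmetric] Q_def[symmetric] a_def[symmetric] b_def[symmetric] c_def[symmetric] .
qed simp

lemma triangle_double: "triangle (2*n) = n * (2*n+1)" "triangle (2*n+1) = (n+1) * (2*n+1)"
  by (simp_all add: triangle_def)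

text \<open>
  D. Shanks's finite form of Gauss's identity. Passing from \<open>n\<close> to \<open>n + 1\<close> adds, by
  \<open>shanks_step\<close>, just the two powers with exponents \<open>triangle (2n)\<close> and \<open>triangle (2n + 1)\<close>.
\<close>
lemma shanks_identity:
  assumes x: "norm x < 1"
  shows "(\<Sum>s<n. gauss_part n x / gauss_part s x * x ^ (s * (2*n+1))) = (\<Sum>j<2*n. x ^ triangle j)"
proof (induction n)
  case (Suc n)
  have cancel: "p / (p * (r / q)) * r * z / q = z" if "p \<noteq> 0" "q \<noteq> 0" "r \<noteq> 0" for p q r z :: complex
    using that by simp
  have e: "2 * Suc n = 2*n+2" "2 * Suc n + 1 = 2*n+3" by simp_all
  define f g where "f s = gauss_part (Suc n) x / gauss_part s x * x ^ (s * (2*n+3))"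
    and "g s = gauss_part n x / gauss_part s x * x ^ (s * (2*n+1))" for s
  have "(\<Sum>s<Suc n. f s - g s) = x ^ (Suc n * (2*n+1))"
    unfolding f_def g_def shanks_step[OF x] e(1)
    unfolding gauss_part_Suc
    by (intro cancel gauss_part_nonzero one_minus_power_nonzero x) simp_all
  then have "(\<Sum>s<Suc n. f s) = (\<Sum>s<Suc n. g s) + x ^ (Suc n * (2*n+1))"
    unfolding sum_subtractf diff_eq_eq by (simp only: add.commute)
  also have "(\<Sum>s<Suc n. g s) = (\<Sum>j<2*n. x ^ triangle j) + x ^ (n * (2*n+1))"
    unfolding sum.lessThan_Suc g_def Suc.IH using gauss_part_nonzero[OF x, of n] by simp
  also have "(\<Sum>j<2*n. x ^ triangle j) + x ^ (n * (2*n+1)) + x ^ (Suc n * (2*n+1)) = (\<Sum>j<2 * Suc n. x ^ triangle j)"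
    using triangle_double[of n] by simp
  finally show ?case
    unfolding f_def e(2) .
qed simp

lemma summable_triangle:
  assumes x: "norm x < 1"
  shows "summable (\<lambda>j. norm (x ^ triangle j :: complex))"
proof (rule summable_comparison_test)
  have "j \<le> triangle j" for j by (induction j) auto
  then show "\<exists>N. \<forall>j\<ge>N. norm (norm (x ^ triangle j)) \<le> norm x ^ j"
    using x by (auto simp: norm_power intro!: power_decreasing)
  show "summable (\<lambda>j. norm x ^ j)" using x by (simp add: summable_geometric)
qed

text \<open>
  Let \<open>n\<close> tend to infinity in Shanks's identity: the term \<open>s = 0\<close> is the partial product itself, and the
  other terms together are \<open>O(n |x|^n)\<close>.
\<close>
lemma gauss_triangular:
  assumes x: "norm x < 1"
  shows "(\<lambda>j. x ^ triangle j) sums (euler_prod (x^2) ^ 2 / euler_prod x)"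
proof -
  define L where "L = euler_prod (x^2) ^ 2 / euler_prod x"
  have L: "(\<lambda>n. gauss_part n x) \<longlonglongrightarrow> L" and "L \<noteq> 0"
    using gauss_part_LIMSEQ[OF x] euler_prod_nonzero x by (auto simp: L_def norm_power_less_1)
  obtain B where B: "norm (gauss_part n x) \<le> B" for n
    using BseqE[OF convergent_imp_Bseq[OF convergentI[OF L]]] by metis
  obtain C where C: "norm (inverse (gauss_part n x)) \<le> C" for n
    using BseqE[OF convergent_imp_Bseq[OF convergentI[OF tendsto_inverse[OF L \<open>L \<noteq> 0\<close>]]]] by metis
  have "B \<ge> 0" "C \<ge> 0" using order_trans[OF norm_ge_zero B] order_trans[OF norm_ge_zero C] by auto
  define R where "R n = (\<Sum>s\<in>{1..<n}. gauss_part n x / gauss_part s x * x ^ (s * (2*n+1)))" for n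
  have bound: "norm (R n) \<le> B * C * (of_nat n * norm x ^ n)" for n
  proof -
    have "norm (R n) \<le> (\<Sum>s\<in>{1..<n}. B * C * norm x ^ n)"
      unfolding R_def
    proof (rule sum_norm_le)
      fix s assume s: "s \<in> {1..<n}"
      have "1 * n \<le> s * (2*n+1)" using s by (intro mult_mono) auto
      then have "norm x ^ (s * (2*n+1)) \<le> norm x ^ n"
        using x by (intro power_decreasing) auto
      then show "norm (gauss_part n x / gauss_part s x * x ^ (s * (2*n+1))) \<le> B * C * norm x ^ n"
        using B[of n] C[of s] \<open>B \<ge> 0\<close> \<open>C \<ge> 0\<close>
        unfolding norm_mult norm_power divide_inverse
        by (intro mult_mono norm_ge_zero zero_le_power mult_nonneg_nonneg)
    qed
    also have "\<dots> = B * C * (real (n - 1) * norm x ^ n)"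
      by simp
    also have "\<dots> \<le> B * C * (real n * norm x ^ n)"
      using \<open>B \<ge> 0\<close> \<open>C \<ge> 0\<close> by (intro mult_left_mono mult_right_mono) auto
    finally show ?thesis .
  qed
  have "(\<lambda>n. B * C * (of_nat n * norm x ^ n)) \<longlonglongrightarrow> B * C * 0"
    using powser_times_n_limit_0[of "norm x"] x by (intro tendsto_intros) (simp add: mult_ac)
  then have R: "R \<longlonglongrightarrow> 0"
    by (intro Lim_null_comparison[OF always_eventually[OF allI[OF bound]]]) simp
  have "(\<Sum>s<Suc n. gauss_part (Suc n) x / gauss_part s x * x ^ (s * (2*Suc n+1))) = gauss_part (Suc n) x + R (Suc n)" for n
    unfolding R_def lessThan_atLeast0 sum.atLeast_Suc_lessThan[OF zero_less_Suc]
    by (simp add: gauss_part_def)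
  then have eq: "(\<Sum>j<2 * Suc n. x ^ triangle j) = gauss_part (Suc n) x + R (Suc n)" for n
    by (simp only: shanks_identity[OF x])
  have "(\<lambda>n. \<Sum>j<2 * Suc n. x ^ triangle j) \<longlonglongrightarrow> L + 0"
    unfolding eq by (intro tendsto_add LIMSEQ_Suc L R)
  then have "(\<lambda>n. \<Sum>j<2 * n. x ^ triangle j) \<longlonglongrightarrow> L"
    using LIMSEQ_imp_Suc[of "\<lambda>n. \<Sum>j<2 * n. x ^ triangle j" L] by (simp only: add_0_right)
  moreover have "summable (\<lambda>j. x ^ triangle j)"
    using summable_triangle[OF x] by (rule summable_norm_cancel)
  then have "(\<lambda>n. \<Sum>j<2 * n. x ^ triangle j) \<longlonglongrightarrow> (\<Sum>j. x ^ triangle j)"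
    by (intro filterlim_compose[OF summable_LIMSEQ filterlim_mult_const_nat]) auto
  ultimately have "L = (\<Sum>j. x ^ triangle j)" by (rule LIMSEQ_unique)
  then show ?thesis
    using summable_sums[OF \<open>summable (\<lambda>j. x ^ triangle j)\<close>] by (simp only: L_def)
qed

section \<open>Schwarzian derivatives and the two rational maps\<close>

lemma schwarzian_cong:
  assumes "eventually (\<lambda>z. f z = g z) (nhds x)"
  shows "schwarzian f x = schwarzian g x"
  using higher_deriv_cong_ev[OF assms refl] deriv_cong_ev[OF assms refl]
  by (simp add: schwarzian_def)

lemma deriv_cong_on_open:
  assumes "open A" "z \<in> A" "\<And>w. w \<in> A \<Longrightarrow> f w = g w"
  shows "deriv f z = deriv g z"
  using assms by (intro deriv_cong_ev eventually_nhds_in_open[THEN eventually_mono]) auto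

lemma higher_derivs_unfold:
  "(deriv ^^ 2) f = deriv (deriv f)" "(deriv ^^ 3) f = deriv (deriv (deriv f))"
  by (simp_all add: eval_nat_numeral)

lemma holomorphic_schwarzian:
  assumes "f holomorphic_on A" "open A" "\<And>z. z \<in> A \<Longrightarrow> deriv f z \<noteq> 0"
  shows "schwarzian f holomorphic_on A"
  unfolding schwarzian_def using assms by (intro holomorphic_intros) auto

text \<open>
  The cocycle property of the Schwarzian derivative, which makes the defect below transform like a
  quadratic differential up to the Schwarzian of the change of variable.
\<close>
lemma schwarzian_compose:
  assumes f: "f holomorphic_on B" and g: "g holomorphic_on A" and "open A" "open B"
    and sub: "g ` A \<subseteq> B" and z: "z \<in> A"
    and f': "deriv f (g z) \<noteq> 0" and g': "deriv g z \<noteq> 0"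
  shows "schwarzian (\<lambda>z. f (g z)) z = schwarzian f (g z) * deriv g z ^ 2 + schwarzian g z"
proof -
  define f1 f2 f3 g1 g2 g3
    where "f1 = deriv f" and "f2 = deriv f1" and "f3 = deriv f2"
      and "g1 = deriv g" and "g2 = deriv g1" and "g3 = deriv g2"
  have hol: "f1 holomorphic_on B" "f2 holomorphic_on B" "g1 holomorphic_on A" "g2 holomorphic_on A"
    unfolding f1_def f2_def g1_def g2_def using assms by (auto intro!: holomorphic_deriv)
  have D: "(h has_field_derivative deriv h w) (at w)" if "h holomorphic_on S" "open S" "w \<in> S" for h w and S :: "complex set"
    using holomorphic_derivI[OF that] by simp
  have df: "(f has_field_derivative f1 (g w)) (at (g w))"
       "(f1 has_field_derivative f2 (g w)) (at (g w))"
       "(f2 has_field_derivative f3 (g w)) (at (g w))" if "w \<in> A" for w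
    unfolding f1_def[THEN fun_cong] f2_def[THEN fun_cong] f3_def[THEN fun_cong]
    using D[OF f \<open>open B\<close>] D[OF hol(1) \<open>open B\<close>] D[OF hol(2) \<open>open B\<close>] sub that
    by (auto simp: f1_def f2_def)
  have dg: "(g has_field_derivative g1 w) (at w)" "(g1 has_field_derivative g2 w) (at w)"
       "(g2 has_field_derivative g3 w) (at w)" if "w \<in> A" for w
    unfolding g1_def[THEN fun_cong] g2_def[THEN fun_cong] g3_def[THEN fun_cong]
    using D[OF g \<open>open A\<close>] D[OF hol(3) \<open>open A\<close>] D[OF hol(4) \<open>open A\<close>] that
    by (auto simp: g1_def g2_def)
  note df' = DERIV_chain2[OF df(1) dg(1)] DERIV_chain2[OF df(2) dg(1)] DERIV_chain2[OF df(3) dg(1)]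
  let ?h = "\<lambda>z. f (g z)"
  have h1: "deriv ?h w = f1 (g w) * g1 w" if "w \<in> A" for w
    by (rule DERIV_imp_deriv) (rule df'[OF that that])
  have h2: "deriv (deriv ?h) w = f2 (g w) * g1 w ^ 2 + f1 (g w) * g2 w" if "w \<in> A" for w
  proof -
    have "deriv (deriv ?h) w = deriv (\<lambda>w. f1 (g w) * g1 w) w"
      using h1 that by (rule deriv_cong_on_open[OF \<open>open A\<close>, rotated])
    also have "\<dots> = f2 (g w) * g1 w ^ 2 + f1 (g w) * g2 w"
      by (rule DERIV_imp_deriv)
         (rule derivative_eq_intros df' dg that refl | simp add: power2_eq_square algebra_simps)+
    finally show ?thesis .
  qed
  have h3: "deriv (deriv (deriv ?h)) w
      = f3 (g w) * g1 w ^ 3 + 3 * f2 (g w) * g1 w * g2 w + f1 (g w) * g3 w" if "w \<in> A" for w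
  proof -
    have "deriv (deriv (deriv ?h)) w = deriv (\<lambda>w. f2 (g w) * g1 w ^ 2 + f1 (g w) * g2 w) w"
      using h2 that by (rule deriv_cong_on_open[OF \<open>open A\<close>, rotated])
    also have "\<dots> = f3 (g w) * g1 w ^ 3 + 3 * f2 (g w) * g1 w * g2 w + f1 (g w) * g3 w"
      by (rule DERIV_imp_deriv)
         (rule derivative_eq_intros df' dg that refl | simp add: power2_eq_square power3_eq_cube algebra_simps)+
    finally show ?thesis .
  qed
  have nz: "f1 (g z) \<noteq> 0" "g1 z \<noteq> 0"
    using f' g' by (simp_all add: f1_def g1_def)
  show ?thesis
    unfolding schwarzian_def higher_derivs_unfold h1[OF z] h2[OF z] h3[OF z]
    unfolding f1_def[symmetric] f2_def[symmetric] f3_def[symmetric] g1_def[symmetric] g2_def[symmetric] g3_def[symmetric]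
    by (simp add: divide_simps nz) algebra
qed

lemma schwarzian_exp:
  assumes "c \<noteq> 0"
  shows "schwarzian (\<lambda>z. exp (c * z)) z = - (c^2) / 2"
proof -
  have 1: "deriv (\<lambda>z. exp (c * z)) = (\<lambda>z. c * exp (c * z))"
    by (rule ext, rule DERIV_imp_deriv) (auto intro!: derivative_eq_intros)
  have 2: "deriv (\<lambda>z. c * exp (c * z)) = (\<lambda>z. c^2 * exp (c * z))"
    by (rule ext, rule DERIV_imp_deriv) (auto intro!: derivative_eq_intros simp: power2_eq_square)
  have 3: "deriv (\<lambda>z. c^2 * exp (c * z)) = (\<lambda>z. c^3 * exp (c * z))"
    by (rule ext, rule DERIV_imp_deriv) (auto intro!: derivative_eq_intros simp: power2_eq_square power3_eq_cube)
  show ?thesis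
    unfolding schwarzian_def higher_derivs_unfold 1 2 3
    using assms by (simp add: field_simps power2_eq_square power3_eq_cube)
qed

lemma schwarzian_cube:
  assumes "x \<noteq> 0"
  shows "schwarzian (\<lambda>x. x^3) x = - 4 / x^2"
proof -
  have 1: "deriv (\<lambda>x::complex. x^3) = (\<lambda>x. 3 * x^2)"
    by (rule ext, rule DERIV_imp_deriv) (auto intro!: derivative_eq_intros)
  have 2: "deriv (\<lambda>x::complex. 3 * x^2) = (\<lambda>x. 6 * x)"
    by (rule ext, rule DERIV_imp_deriv) (auto intro!: derivative_eq_intros)
  have 3: "deriv (\<lambda>x::complex. 6 * x) = (\<lambda>x. 6)"
    by (rule ext, rule DERIV_imp_deriv) (auto intro!: derivative_eq_intros)
  show ?thesis
    unfolding schwarzian_def higher_derivs_unfold 1 2 3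
    by (simp add: divide_simps assms) algebra
qed

text \<open>
  The two rational maps of the cubic transformation: they send the parameter \<open>Y\<close> to the values of the
  hauptmodul at \<open>x\<close> and at \<open>x^3\<close>.
\<close>
definition param_map :: "complex \<Rightarrow> complex" where "param_map y = y * (1 + 3*y + 3*y^2)"
definition param_map_cube :: "complex \<Rightarrow> complex" where "param_map_cube y = y^3 / (1 + 3*y + 3*y^2)"

text \<open>
  The coefficient of the claimed equation. Its poles \<open>0\<close>, \<open>-1\<close>, \<open>-1/9\<close> are values that the hauptmodul
  omits on the punctured disc.
\<close>
definition potential :: "complex \<Rightarrow> complex" where
  "potential u = (81*u^4 + 108*u^3 + 102*u^2 + 12*u + 1) / (2 * u^2 * (u+1)^2 * (9*u+1)^2)"

lemma deriv_param_map: "deriv param_map = (\<lambda>y. (1 + 3*y)^2)"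
  unfolding param_map_def[abs_def]
  by (rule ext, rule DERIV_imp_deriv) (auto intro!: derivative_eq_intros simp: algebra_simps power2_eq_square)

lemma schwarzian_param_map:
  assumes "1 + 3*y \<noteq> 0"
  shows "schwarzian param_map y = - 36 / (1 + 3*y)^2"
proof -
  have 2: "deriv (\<lambda>y::complex. (1 + 3*y)^2) = (\<lambda>y. 6 * (1 + 3*y))"
    by (rule ext, rule DERIV_imp_deriv) (auto intro!: derivative_eq_intros)
  have 3: "deriv (\<lambda>y::complex. 6 * (1 + 3*y)) = (\<lambda>y. 18)"
    by (rule ext, rule DERIV_imp_deriv) (auto intro!: derivative_eq_intros)
  show ?thesis
    unfolding schwarzian_def higher_derivs_unfold deriv_param_map 2 3
    by (simp add: divide_simps assms) algebra
qed

text \<open>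
  The map is critical only at \<open>0\<close> and \<open>-1\<close>. Its values there, \<open>0\<close> and \<open>-1\<close>, are singular points of
  \<open>potential\<close>; so ramification gives the pullback of \<open>potential\<close> no further poles.
\<close>
lemma deriv_param_map_cube:
  assumes "1 + 3*y + 3*y^2 \<noteq> 0"
  shows "deriv param_map_cube y = 3 * y^2 * (1 + y)^2 / (1 + 3*y + 3*y^2)^2"
  unfolding param_map_cube_def[abs_def]
  by (rule DERIV_imp_deriv) (rule derivative_eq_intros refl assms | simp add: divide_simps assms | algebra)+

lemma open_param_map_cube_domain: "open {y::complex. 1 + 3*y + 3*y^2 \<noteq> 0}"
  by (intro open_Collect_neq continuous_intros)

lemma holomorphic_param_map: "param_map holomorphic_on UNIV"
  unfolding param_map_def[abs_def] by (intro holomorphic_intros)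

lemma holomorphic_param_map_cube: "param_map_cube holomorphic_on {y. 1 + 3*y + 3*y^2 \<noteq> 0}"
  unfolding param_map_cube_def[abs_def] by (intro holomorphic_intros) auto

text \<open>
  With \<open>d = 1 + 3y + 3y^2\<close> the logarithmic derivative of the first derivative collapses to
  \<open>2 (1 + 2y) / (y (1 + y) d)\<close>, because \<open>d - 3 y (1 + y) = 1\<close>; the remaining numerator is \<open>-4 d^2\<close>.
\<close>
lemma schwarzian_param_map_cube:
  assumes d: "1 + 3*y + 3*y^2 \<noteq> 0" and y: "y \<noteq> 0" "1 + y \<noteq> 0"
  shows "schwarzian param_map_cube y = - 4 / (y^2 * (1 + y)^2)"
proof -
  define A where "A = {y::complex. 1 + 3*y + 3*y^2 \<noteq> 0}"
  have A: "open A" "y \<in> A"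
    using d open_param_map_cube_domain by (auto simp: A_def)
  have 1: "deriv param_map_cube w = 3 * w^2 * (1 + w)^2 / (1 + 3*w + 3*w^2)^2" if "w \<in> A" for w
    using that by (intro deriv_param_map_cube) (auto simp: A_def)
  have 2: "deriv (deriv param_map_cube) w = 6 * w * (1 + w) * (1 + 2*w) / (1 + 3*w + 3*w^2)^3" if "w \<in> A" for w
  proof -
    have nz: "1 + 3*w + 3*w^2 \<noteq> 0" using that by (auto simp: A_def)
    have "deriv (deriv param_map_cube) w = deriv (\<lambda>w. 3 * w^2 * (1 + w)^2 / (1 + 3*w + 3*w^2)^2) w"
      using 1 that by (rule deriv_cong_on_open[OF A(1), rotated])
    also have "\<dots> = 6 * w * (1 + w) * (1 + 2*w) / (1 + 3*w + 3*w^2)^3"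
      by (rule DERIV_imp_deriv) (rule derivative_eq_intros refl | simp add: divide_simps nz | algebra)+
    finally show ?thesis .
  qed
  have 3: "deriv (deriv (deriv param_map_cube)) y = deriv (\<lambda>w. 6 * w * (1 + w) * (1 + 2*w) / (1 + 3*w + 3*w^2)^3) y"
    using 2 A by (intro deriv_cong_on_open) auto
  have 4: "deriv (\<lambda>w. 6 * w * (1 + w) * (1 + 2*w) / (1 + 3*w + 3*w^2)^3) y
     = (6 * (1 + 6*y + 6*y^2) * (1 + 3*y + 3*y^2) - 18 * y * (1 + y) * (1 + 2*y) * (3 + 6*y)) / (1 + 3*y + 3*y^2)^4"
    by (rule DERIV_imp_deriv) (rule derivative_eq_intros refl | simp add: divide_simps d | algebra)+
  define D where "D = 1 + 3*y + 3*y^2"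
  have D: "D \<noteq> 0" using d by (simp add: D_def)
  have a: "(deriv ^^ 2) param_map_cube y / deriv param_map_cube y = 2 * (1 + 2*y) / (y * (1 + y) * D)"
    unfolding higher_derivs_unfold 1[OF A(2)] 2[OF A(2)] D_def[symmetric]
    by (simp add: divide_simps D y) algebra
  have b: "(deriv ^^ 3) param_map_cube y / deriv param_map_cube y
     = (2 * (1 + 6*y + 6*y^2) * D - 6 * y * (1 + y) * (1 + 2*y) * (3 + 6*y)) / (y * (1 + y) * D)^2"
    unfolding higher_derivs_unfold 1[OF A(2)] 3 4 D_def[symmetric]
    by (simp add: divide_simps D y)
  have "schwarzian param_map_cube y * (y * (1 + y) * D)^2
      = 2 * (1 + 6*y + 6*y^2) * D - 6 * y * (1 + y) * (1 + 2*y) * (3 + 6*y) - 6 * (1 + 2*y)^2"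
    unfolding schwarzian_def a b by (simp add: divide_simps D y) algebra
  also have "\<dots> = - 4 * D^2"
    unfolding D_def by algebra
  finally have "(schwarzian param_map_cube y * (y * (1 + y))^2) * D^2 = (-4) * D^2"
    by (simp add: power_mult_distrib mult_ac)
  then have "schwarzian param_map_cube y * (y * (1 + y))^2 = -4"
    using D by (simp only: mult_cancel_right power_eq_0_iff) simp
  moreover have "y^2 * (1 + y)^2 \<noteq> 0"
    using y by simp
  ultimately show ?thesis
    using nonzero_eq_divide_eq by (metis power_mult_distrib)
qed

text \<open>
  The algebraic core. Under either map the points over \<open>0\<close>, \<open>-1\<close>, \<open>-1/9\<close>, \<open>\<infinity>\<close> are \<open>0\<close>, \<open>-1\<close>,
  \<open>-1/3\<close>, \<open>\<infinity>\<close> and the roots of \<open>1 + 3y^2\<close> and \<open>1 + 3y + 3y^2\<close>, so the two sides have the same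
  possible poles. Cleared of the common denominator \<open>M\<close>, the statement is a polynomial identity.
\<close>
lemma param_maps_same_pullback:
  assumes d: "1 + 3*y + 3*y^2 \<noteq> 0" and y: "y \<noteq> 0" "1 + y \<noteq> 0" "1 + 3*y \<noteq> 0" "1 + 3*y^2 \<noteq> 0"
  shows "schwarzian param_map y + potential (param_map y) * deriv param_map y ^ 2
    = schwarzian param_map_cube y + potential (param_map_cube y) * deriv param_map_cube y ^ 2"
proof -
  define D where "D = 1 + 3*y + 3*y^2"
  define M where "M = 2 * y^2 * D^2 * (1+y)^2 * (1+3*y^2)^2 * (1+3*y)^2"
  have D: "D \<noteq> 0" using d by (simp add: D_def)
  have M: "M \<noteq> 0" using D y by (simp add: M_def)
  define n1 where "n1 = 81 * (y*D)^4 + 108 * (y*D)^3 + 102 * (y*D)^2 + 12 * (y*D) + 1"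
  define n3 where "n3 = 81 * y^12 + 108 * y^9 * D + 102 * y^6 * D^2 + 12 * y^3 * D^3 + D^4"
  have f1: "y * D + 1 = (1 + y) * (1 + 3*y^2)" "9 * (y * D) + 1 = (1 + 3*y)^3"
    unfolding D_def by algebra+
  have f3: "y^3 / D + 1 = (1 + y)^3 / D" "9 * (y^3 / D) + 1 = (1 + 3*y) * (1 + 3*y^2) / D"
    by (simp_all add: divide_simps D) (unfold D_def, algebra, algebra)
  have 1: "potential (param_map y) * deriv param_map y ^ 2 = n1 / M"
    unfolding potential_def param_map_def deriv_param_map D_def[symmetric] f1 n1_def[symmetric] M_def
    by (simp add: divide_simps D y)
  have n3: "81 * (y^3 / D)^4 + 108 * (y^3 / D)^3 + 102 * (y^3 / D)^2 + 12 * (y^3 / D) + 1 = n3 / D^4"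
    unfolding n3_def using D by (simp add: field_simps eval_nat_numeral)
  have 3: "potential (param_map_cube y) * deriv param_map_cube y ^ 2 = 9 * n3 / M"
    unfolding potential_def param_map_cube_def deriv_param_map_cube[OF d] D_def[symmetric] f3 n3 M_def
    by (simp add: divide_simps D y) algebra
  have "n1 - 72 * y^2 * D^2 * (1+y)^2 * (1+3*y^2)^2 = 9 * n3 - 8 * D^2 * (1+3*y^2)^2 * (1+3*y)^2"
    unfolding n1_def n3_def D_def by algebra
  moreover have "- 36 / (1 + 3*y)^2 = - (72 * y^2 * D^2 * (1+y)^2 * (1+3*y^2)^2) / M"
    unfolding M_def by (simp add: divide_simps D y)
  moreover have "- 4 / (y^2 * (1 + y)^2) = - (8 * D^2 * (1+3*y^2)^2 * (1+3*y)^2) / M"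
    unfolding M_def by (simp add: divide_simps D y)
  ultimately show ?thesis
    unfolding schwarzian_param_map[OF y(3)] schwarzian_param_map_cube[OF d y(1,2)] 1 3
    by (simp flip: add_divide_distrib diff_divide_distrib)
qed

section \<open>Trisection of the theta series\<close>

text \<open>
  This is \<open>\<psi>(-x)\<close> for the theta function \<open>\<psi>(x) = \<Sum> x^(j(j+1)/2)\<close>, and up to a power of \<open>x\<close> it is
  \<open>\<eta>(z) \<eta>(4z) / \<eta>(2z)\<close> with \<open>x = exp (2 \<pi> i z)\<close>. In terms of it the eta quotient is a fourth power,
  apart from the factor \<open>x\<close>.
\<close>
definition psi_minus :: "complex \<Rightarrow> complex" where
  "psi_minus x = euler_prod x * euler_prod (x^4) / euler_prod (x^2)"

lemma psi_minus_nonzero: "norm x < 1 \<Longrightarrow> psi_minus x \<noteq> 0"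
  by (simp add: psi_minus_def euler_prod_nonzero norm_power_less_1)

lemma psi_minus_0 [simp]: "psi_minus 0 = 1"
  by (simp add: psi_minus_def)

lemma holomorphic_euler_prod_compose:
  assumes "f holomorphic_on A" "\<And>z. z \<in> A \<Longrightarrow> norm (f z) < 1"
  shows "(\<lambda>z. euler_prod (f z)) holomorphic_on A"
  using holomorphic_on_compose_gen[OF assms(1) holomorphic_euler_prod] assms(2)
  by (simp add: o_def image_subset_iff)

lemma holomorphic_psi_minus: "psi_minus holomorphic_on ball 0 1"
  unfolding psi_minus_def[abs_def]
  by (intro holomorphic_intros holomorphic_euler_prod_compose euler_prod_nonzero)
     (auto simp: norm_power_less_1)

lemma holomorphic_psi_minus_compose:
  assumes "f holomorphic_on A" "\<And>z. z \<in> A \<Longrightarrow> norm (f z) < 1"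
  shows "(\<lambda>z. psi_minus (f z)) holomorphic_on A"
  using holomorphic_on_compose_gen[OF assms(1) holomorphic_psi_minus] assms(2)
  by (simp add: o_def image_subset_iff)

lemma psi_minus_sums:
  assumes x: "norm x < 1"
  shows "(\<lambda>j. (-x) ^ triangle j) sums psi_minus x"
proof -
  have "euler_prod x \<noteq> 0" "euler_prod (-x) \<noteq> 0" "euler_prod (x^4) \<noteq> 0" "euler_prod (x^2) \<noteq> 0"
    using x by (auto intro!: euler_prod_nonzero simp: norm_power_less_1)
  then have "euler_prod ((-x)^2) ^ 2 / euler_prod (-x) = psi_minus x"
    using euler_prod_minus[OF x] unfolding psi_minus_def
    by (simp add: divide_simps power2_eq_square power3_eq_cube mult_ac)
  with gauss_triangular[of "-x"] x show ?thesis by simp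
qed

lemma triangle_triple:
  "triangle (3*k) = 3 * (3 * triangle k - k)" "triangle (3*k+1) = 9 * triangle k + 1"
  "triangle (3*k+2) = 3 * (3 * triangle k + k + 1)"
proof -
  have le: "k \<le> triangle k" for k by (induction k) auto
  have "triangle (3*k) + 3 * k = 9 * triangle k"
  proof (induction k)
    case (Suc k)
    have "triangle (Suc (Suc (Suc m))) = triangle m + 3 * m + 6" for m by simp
    moreover have "3 * Suc k = Suc (Suc (Suc (3 * k)))" by simp
    ultimately have "triangle (3 * Suc k) = triangle (3 * k) + 9 * k + 6" by presburger
    with Suc.IH show ?case by simp
  qed simp
  then show "triangle (3*k) = 3 * (3 * triangle k - k)" "triangle (3*k+1) = 9 * triangle k + 1"
    "triangle (3*k+2) = 3 * (3 * triangle k + k + 1)"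
    using le[of k] by (simp_all add: diff_mult_distrib2)
qed

text \<open>
  Of the triangular numbers only those with index \<open>3k + 1\<close> are not divisible by \<open>3\<close>, and these equal
  \<open>9 \<cdot> triangle k + 1\<close>. Taking them out of the series leaves a power series in \<open>x^3\<close>.
\<close>
lemma psi_minus_dissection:
  assumes x: "norm x < 1"
  shows "(\<lambda>k. (-x) ^ triangle (3*k) + (-x) ^ triangle (3*k+2)) sums (psi_minus x + x * psi_minus (x^9))"
proof -
  have "(\<lambda>k. \<Sum>j=3*k..<3*k+3. (-x) ^ triangle j) sums psi_minus x"
    using sums_group[OF psi_minus_sums[OF x], of 3] by (simp add: mult.commute)
  moreover have "(\<Sum>j=3*k..<3*k+3. (-x) ^ triangle j)
      = (-x) ^ triangle (3*k) + (-x) ^ triangle (3*k+1) + (-x) ^ triangle (3*k+2)" for k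
    by (simp add: numeral_3_eq_3 numeral_2_eq_2)
  ultimately have 1: "(\<lambda>k. (-x) ^ triangle (3*k) + (-x) ^ triangle (3*k+1) + (-x) ^ triangle (3*k+2)) sums psi_minus x"
    by simp
  have 2: "(\<lambda>k. - x * (- (x^9)) ^ triangle k) sums (- x * psi_minus (x^9))"
    using x by (intro sums_mult psi_minus_sums) (simp add: norm_power_less_1)
  have "(-x) ^ triangle (3*k+1) = - x * (- (x^9)) ^ triangle k" for k
    unfolding triangle_triple by (simp add: power_mult)
  with sums_diff[OF 1 2] show ?thesis
    by (simp only:) (simp add: algebra_simps)
qed

text \<open>
  The series of \<open>psi_minus_dissection\<close> is unchanged if \<open>x\<close> is multiplied by a cube root of unity.
\<close>
lemma psi_minus_dissection_invariant:
  assumes x: "norm x < 1" and w: "w^3 = 1" "norm w = 1"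
  shows "psi_minus (w*x) = psi_minus x + x * psi_minus (x^9) - w * x * psi_minus (x^9)"
proof -
  have wx: "norm (w*x) < 1" using x w by (simp add: norm_mult)
  have pow: "(-(w*x)) ^ (3*n) = (-x) ^ (3*n)" for n
  proof -
    have "(-(w*x)) ^ (3*n) = (w^3) ^ n * (-x) ^ (3*n)"
      by (simp flip: power_mult power_mult_distrib)
    then show ?thesis using w by simp
  qed
  have "w^9 = (w^3)^3" by (simp flip: power_mult)
  then have "(w*x)^9 = x^9" using w by (simp add: power_mult_distrib)
  with psi_minus_dissection[OF wx]
  have "(\<lambda>k. (-x) ^ triangle (3*k) + (-x) ^ triangle (3*k+2))
      sums (psi_minus (w*x) + w * x * psi_minus (x^9))"
    unfolding triangle_triple pow by simp
  from sums_unique2[OF this psi_minus_dissection[OF x]] show ?thesis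
    by (simp add: algebra_simps)
qed

lemma psi_minus_triple:
  assumes x: "norm x < 1" and w: "1 + w + w^2 = 0" "norm w = 1"
  shows "psi_minus x * psi_minus (w*x) * psi_minus (w^2*x) * psi_minus (x^9) = psi_minus (x^3) ^ 4"
proof -
  have w3: "w^3 = 1" using w(1) by algebra
  have w4: "w^4 = w" "(w^2)^2 = w" "(w^2)^4 = w^2" using w3 by algebra+
  have e: "norm (x^2) < 1" "norm (x^4) < 1" using x by (auto simp: norm_power_less_1)
  note t = euler_prod_triple[OF x w] euler_prod_triple[OF e(1) w] euler_prod_triple[OF e(2) w]
  have "psi_minus x * psi_minus (w*x) * psi_minus (w^2*x) * psi_minus (x^9)
     = (euler_prod x * euler_prod (w*x) * euler_prod (w^2*x) * euler_prod (x^9))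
      * (euler_prod (x^4) * euler_prod (w*x^4) * euler_prod (w^2*x^4) * euler_prod ((x^4)^9))
      / (euler_prod (x^2) * euler_prod (w*x^2) * euler_prod (w^2*x^2) * euler_prod ((x^2)^9))"
    unfolding psi_minus_def power_mult_distrib w4 by (simp flip: power_mult add: mult_ac)
  also have "\<dots> = psi_minus (x^3) ^ 4"
    unfolding t psi_minus_def by (simp flip: power_mult add: power_mult_distrib power_divide mult_ac)
  finally show ?thesis .
qed

section \<open>The function on the disc and its cubic transformation\<close>

text \<open>
  The eta quotient of the theorem as a function of \<open>x = exp (i \<pi> \<tau>)\<close>; after \<open>x \<mapsto> -x\<close> it is the
  classical hauptmodul of \<open>\<Gamma>\<^sub>0(6)\<close> up to sign.
\<close>
definition hauptmodul :: "complex \<Rightarrow> complex" where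
  "hauptmodul x = x * (psi_minus (x^3) / psi_minus x) ^ 4"

definition cubic_param :: "complex \<Rightarrow> complex" where
  "cubic_param x = x * psi_minus (x^9) / psi_minus x"

text \<open>
  By the trisection, the product of \<open>psi_minus\<close> over \<open>x, \<omega>x, \<omega>^2 x\<close> is \<open>(a + b)^3 - b^3\<close> with
  \<open>a = psi_minus x\<close> and \<open>b = x \<cdot> psi_minus (x^9)\<close>. The infinite products evaluate it as
  \<open>psi_minus (x^3)^4 / psi_minus (x^9)\<close>.
\<close>
lemma cubic_param_quadratic:
  assumes x: "norm x < 1"
  shows "1 + 3 * cubic_param x + 3 * cubic_param x ^ 2 = psi_minus (x^3) ^ 4 / (psi_minus (x^9) * psi_minus x ^ 3)"
proof -
  define w where "w = Complex (- 1 / 2) (sqrt 3 / 2)"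
  have w: "1 + w + w^2 = 0" "norm w = 1"
    by (simp_all add: w_def complex_eq_iff cmod_def power2_eq_square)
  have w3: "w^3 = 1" "(w^2)^3 = 1" "norm (w^2) = 1" using w(1) by algebra+ (simp add: w(2) norm_power)
  have nz: "psi_minus x \<noteq> 0" "psi_minus (x^9) \<noteq> 0"
    using x by (auto intro!: psi_minus_nonzero simp: norm_power_less_1)
  define a b where "a = psi_minus x" and "b = x * psi_minus (x^9)"
  have "psi_minus (x^3) ^ 4 = a * (a + b - w * b) * (a + b - w^2 * b) * psi_minus (x^9)"
    unfolding psi_minus_triple[OF x w, symmetric]
      psi_minus_dissection_invariant[OF x w3(1) w(2)] psi_minus_dissection_invariant[OF x w3(2,3)]
    by (simp add: a_def b_def mult_ac)
  also have "a * (a + b - w * b) * (a + b - w^2 * b) = a^3 + 3 * a^2 * b + 3 * a * b^2"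
    using w(1) by algebra
  finally have "psi_minus (x^3) ^ 4 / (psi_minus (x^9) * psi_minus x ^ 3) = (a^3 + 3 * a^2 * b + 3 * a * b^2) / a^3"
    using nz by (simp add: a_def)
  also have "\<dots> = 1 + 3 * (b / a) + 3 * (b / a)^2"
    using nz by (simp add: a_def[symmetric] field_simps eval_nat_numeral)
  finally show ?thesis by (simp add: cubic_param_def a_def b_def)
qed

text \<open>
  The first equation restates \<open>cubic_param_quadratic\<close>, and the second follows from it because the
  product of the values of the hauptmodul at \<open>x\<close> and \<open>x^3\<close> is the fourth power of the parameter.
\<close>
lemma hauptmodul_conv_param:
  assumes x: "norm x < 1"
  shows "hauptmodul x = param_map (cubic_param x)" "hauptmodul (x^3) = param_map_cube (cubic_param x)"
    and "1 + 3 * cubic_param x + 3 * cubic_param x ^ 2 \<noteq> 0"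
proof -
  define a b c where "a = psi_minus x" and "b = psi_minus (x^3)" and "c = psi_minus (x^9)"
  have nz: "a \<noteq> 0" "b \<noteq> 0" "c \<noteq> 0"
    using x by (auto intro!: psi_minus_nonzero simp: a_def b_def c_def norm_power_less_1)
  have q: "1 + 3 * cubic_param x + 3 * cubic_param x ^ 2 = b^4 / (c * a^3)"
    using cubic_param_quadratic[OF x] by (simp add: a_def b_def c_def)
  have p: "cubic_param x = x * c / a"
    by (simp add: cubic_param_def a_def c_def)
  show "1 + 3 * cubic_param x + 3 * cubic_param x ^ 2 \<noteq> 0"
    unfolding q using nz by simp
  show "hauptmodul x = param_map (cubic_param x)"
    unfolding param_map_def q unfolding p hauptmodul_def a_def[symmetric] b_def[symmetric]
    using nz by (simp add: field_simps eval_nat_numeral)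
  have cube: "(x^3)^3 = x^9" by (simp flip: power_mult)
  show "hauptmodul (x^3) = param_map_cube (cubic_param x)"
    unfolding param_map_cube_def q unfolding p hauptmodul_def cube b_def[symmetric] c_def[symmetric]
    using nz by (simp add: field_simps eval_nat_numeral)
qed

lemma holomorphic_cubic_param: "cubic_param holomorphic_on ball 0 1"
  unfolding cubic_param_def[abs_def]
  by (intro holomorphic_intros holomorphic_psi_minus_compose psi_minus_nonzero)
     (auto simp: norm_power_less_1)

lemma holomorphic_hauptmodul: "hauptmodul holomorphic_on ball 0 1"
  unfolding hauptmodul_def[abs_def]
  by (intro holomorphic_intros holomorphic_psi_minus_compose psi_minus_nonzero)
     (auto simp: norm_power_less_1)

lemma hauptmodul_0 [simp]: "hauptmodul 0 = 0"
  by (simp add: hauptmodul_def)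

lemma hauptmodul_nonzero: "norm x < 1 \<Longrightarrow> x \<noteq> 0 \<Longrightarrow> hauptmodul x \<noteq> 0"
  by (simp add: hauptmodul_def psi_minus_nonzero norm_power_less_1)

lemma deriv_hauptmodul_0: "deriv hauptmodul 0 = 1"
proof -
  define V where "V x = (psi_minus (x^3) / psi_minus x) ^ 4" for x
  have "V holomorphic_on ball 0 1"
    unfolding V_def[abs_def]
    by (intro holomorphic_intros holomorphic_psi_minus_compose psi_minus_nonzero)
       (auto simp: norm_power_less_1)
  then have "(V has_field_derivative deriv V 0) (at 0)"
    by (rule holomorphic_derivI) auto
  from DERIV_mult[OF DERIV_ident this] have "((\<lambda>x. x * V x) has_field_derivative 1) (at 0)"
    by (simp add: V_def)
  moreover have "hauptmodul = (\<lambda>x. x * V x)"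
    by (simp add: fun_eq_iff hauptmodul_def V_def)
  ultimately show ?thesis
    by (simp add: DERIV_imp_deriv)
qed

section \<open>Omitted values and critical points\<close>

lemma filterlim_three_power: "filterlim (\<lambda>n::nat. 3^n :: nat) sequentially sequentially"
  by (rule filterlim_subseq) (simp add: strict_mono_def)

lemma tendsto_power_three_power:
  assumes "norm (x::complex) < 1"
  shows "(\<lambda>n. x ^ (3^n)) \<longlonglongrightarrow> 0"
  by (rule filterlim_compose[OF LIMSEQ_power_zero[OF assms] filterlim_three_power])

text \<open>
  A property that passes from \<open>y\<close> to \<open>y^3\<close> holds along the sequence \<open>x^(3^n)\<close>, which tends to \<open>0\<close>; a
  closed condition implied by it therefore holds at the centre of the disc.
\<close>
lemma cubing_invariant_limit:
  assumes x: "norm (x::complex) < 1" and "P x"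
    and step: "\<And>y. norm y < 1 \<Longrightarrow> P y \<Longrightarrow> P (y^3)"
    and cont: "isCont f 0" and closed: "closed S" and P: "\<And>y. norm y < 1 \<Longrightarrow> P y \<Longrightarrow> f y \<in> S"
  shows "f 0 \<in> S"
proof -
  have n: "norm (x ^ (3^n)) < 1" for n
    using x by (intro norm_power_less_1) auto
  have "P (x ^ (3^n))" for n
  proof (induction n)
    case (Suc n)
    have "x ^ (3 ^ Suc n) = (x ^ (3^n))^3"
      by (simp flip: power_mult add: mult.commute)
    with step[OF n Suc.IH] show ?case by simp
  qed (use \<open>P x\<close> in simp)
  then have "f (x ^ (3^n)) \<in> S" for n
    using P[OF n] by blast
  then show ?thesis
    using closed isCont_tendsto_compose[OF cont tendsto_power_three_power[OF x]]
    by (intro Lim_in_closed_set[of S]) auto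
qed

lemma isCont_0_if_holomorphic: "f holomorphic_on ball 0 1 \<Longrightarrow> isCont f 0" for f :: "complex \<Rightarrow> complex"
  using continuous_on_interior[OF holomorphic_on_imp_continuous_on, of f "ball 0 1" 0] by simp

lemma param_map_factors:
  "param_map y + 1 = (1 + y) * (1 + 3*y^2)" "9 * param_map y + 1 = (1 + 3*y)^3"
  unfolding param_map_def by algebra+

lemma param_map_cube_factors:
  assumes "1 + 3*y + 3*y^2 \<noteq> 0"
  shows "param_map_cube y + 1 = (1 + y)^3 / (1 + 3*y + 3*y^2)"
    and "9 * param_map_cube y + 1 = (1 + 3*y) * (1 + 3*y^2) / (1 + 3*y + 3*y^2)"
  unfolding param_map_cube_def by (simp add: divide_simps assms, algebra)+

text \<open>
  If the hauptmodul takes one of the values \<open>-1\<close>, \<open>-1/9\<close> at \<open>y\<close>, the factorizations show that it takes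
  one of them at \<open>y^3\<close> as well. It would then do so at \<open>0\<close>, where it vanishes.
\<close>
lemma hauptmodul_omits:
  assumes x: "norm x < 1"
  shows "hauptmodul x + 1 \<noteq> 0" "9 * hauptmodul x + 1 \<noteq> 0"
proof -
  let ?P = "\<lambda>u::complex. (u + 1) * (9 * u + 1)"
  have step: "?P (hauptmodul (y^3)) = 0" if y: "norm y < 1" and P: "?P (hauptmodul y) = 0" for y
  proof -
    have "(1 + cubic_param y) * (1 + 3 * cubic_param y ^ 2) * (1 + 3 * cubic_param y)^3 = 0"
      using P unfolding hauptmodul_conv_param(1)[OF y] param_map_factors .
    then show ?thesis
      unfolding hauptmodul_conv_param(2)[OF y] param_map_cube_factors[OF hauptmodul_conv_param(3)[OF y]] by auto
  qed
  have "?P (hauptmodul x) \<noteq> 0"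
  proof
    assume "?P (hauptmodul x) = 0"
    then have "?P (hauptmodul 0) \<in> {0}"
      using x step isCont_0_if_holomorphic[OF holomorphic_hauptmodul]
      by (intro cubing_invariant_limit[of x "\<lambda>y. ?P (hauptmodul y) = 0" "\<lambda>y. ?P (hauptmodul y)"])
         (auto intro!: continuous_intros simp del: mult_eq_0_iff)
    then show False by simp
  qed
  then show "hauptmodul x + 1 \<noteq> 0" "9 * hauptmodul x + 1 \<noteq> 0" by auto
qed

lemma cubic_param_factors_nonzero:
  assumes x: "norm x < 1"
  shows "1 + cubic_param x \<noteq> 0" "1 + 3 * cubic_param x \<noteq> 0" "1 + 3 * cubic_param x ^ 2 \<noteq> 0"
  using hauptmodul_omits[OF x] unfolding hauptmodul_conv_param(1)[OF x] param_map_factors by auto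

lemma deriv_hauptmodul_chain:
  assumes x: "norm x < 1"
  shows "deriv hauptmodul x = deriv param_map (cubic_param x) * deriv cubic_param x"
    and "deriv hauptmodul (x^3) * (3 * x^2) = deriv param_map_cube (cubic_param x) * deriv cubic_param x"
proof -
  have xb: "x \<in> ball 0 1" using x by simp
  have D: "(cubic_param has_field_derivative deriv cubic_param x) (at x)"
    "(param_map has_field_derivative deriv param_map (cubic_param x)) (at (cubic_param x))"
    "(param_map_cube has_field_derivative deriv param_map_cube (cubic_param x)) (at (cubic_param x))"
    "(hauptmodul has_field_derivative deriv hauptmodul (x^3)) (at (x^3))"
    using holomorphic_derivI[OF holomorphic_cubic_param _ xb] holomorphic_derivI[OF holomorphic_param_map, of "cubic_param x"]
      holomorphic_derivI[OF holomorphic_param_map_cube open_param_map_cube_domain, of "cubic_param x"] hauptmodul_conv_param(3)[OF x]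
      holomorphic_derivI[OF holomorphic_hauptmodul, of "x^3"] x norm_power_less_1[OF x, of 3]
    by simp_all
  have "deriv hauptmodul x = deriv (\<lambda>x. param_map (cubic_param x)) x"
    by (rule deriv_cong_on_open[OF _ xb]) (auto simp: hauptmodul_conv_param)
  also have "\<dots> = deriv param_map (cubic_param x) * deriv cubic_param x"
    by (rule DERIV_imp_deriv) (rule DERIV_chain2[OF D(2,1)])
  finally show "deriv hauptmodul x = deriv param_map (cubic_param x) * deriv cubic_param x" .
  have "deriv (\<lambda>x. hauptmodul (x^3)) x = deriv (\<lambda>x. param_map_cube (cubic_param x)) x"
    by (rule deriv_cong_on_open[OF _ xb]) (auto simp: hauptmodul_conv_param)
  also have "\<dots> = deriv param_map_cube (cubic_param x) * deriv cubic_param x"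
    by (rule DERIV_imp_deriv) (rule DERIV_chain2[OF D(3,1)])
  also have "deriv (\<lambda>x. hauptmodul (x^3)) x = deriv hauptmodul (x^3) * (3 * x^2)"
    by (rule DERIV_imp_deriv, rule DERIV_chain2[where g = "\<lambda>x. x^3", OF D(4)]) (auto intro!: derivative_eq_intros)
  finally show "deriv hauptmodul (x^3) * (3 * x^2) = deriv param_map_cube (cubic_param x) * deriv cubic_param x" .
qed

text \<open>
  Since \<open>param_map\<close> is critical only at \<open>-1/3\<close>, where its value is the omitted value \<open>-1/9\<close>, a critical
  point of the hauptmodul is a critical point of the parameter, and so, through the other map, its cube
  is critical again. But \<open>0\<close> is not critical.
\<close>
lemma deriv_hauptmodul_nonzero:
  assumes x: "norm x < 1"
  shows "deriv hauptmodul x \<noteq> 0"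
proof
  assume d: "deriv hauptmodul x = 0"
  have hol: "deriv hauptmodul holomorphic_on ball 0 1"
    by (intro holomorphic_deriv holomorphic_hauptmodul) auto
  have step: "deriv hauptmodul (y^3) = 0" if y: "norm y < 1" and d: "deriv hauptmodul y = 0" for y
  proof (cases "y = 0")
    case False
    have "deriv cubic_param y = 0"
      using d cubic_param_factors_nonzero(2)[OF y] unfolding deriv_hauptmodul_chain(1)[OF y] deriv_param_map by simp
    with deriv_hauptmodul_chain(2)[OF y] False show ?thesis by simp
  qed (use d in simp)
  have "deriv hauptmodul 0 \<in> {0}"
    by (rule cubing_invariant_limit[where P = "\<lambda>y. deriv hauptmodul y = 0",
          OF x d step isCont_0_if_holomorphic[OF hol] closed_singleton]) simp_all
  then show False by (simp add: deriv_hauptmodul_0)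
qed

section \<open>The functional equation of the defect\<close>

text \<open>
  The left-hand side of the claimed equation with \<open>x\<close> in place of \<open>\<tau>\<close> as the variable. It is not zero:
  the coordinate change \<open>x = exp (i \<pi> \<tau>)\<close> has a Schwarzian derivative of its own, which accounts for the
  value \<open>1 / (2 x^2)\<close> found in \<open>schwarzian_defect_eq\<close>.
\<close>
definition schwarzian_defect :: "complex \<Rightarrow> complex" where
  "schwarzian_defect x = schwarzian hauptmodul x + potential (hauptmodul x) * deriv hauptmodul x ^ 2"

text \<open>
  Express both hauptmodul values through the parameter: by the chain rule each side equals the
  Schwarzian derivative of the parameter plus the common pullback from \<open>param_maps_same_pullback\<close>. The
  factor \<open>9 x^4\<close> is the squared derivative of \<open>x^3\<close>, and \<open>-4 / x^2\<close> is its Schwarzian derivative.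
\<close>
lemma schwarzian_defect_cube:
  assumes x: "norm x < 1" "x \<noteq> 0"
  shows "schwarzian_defect x = 9 * x^4 * schwarzian_defect (x^3) - 4 / x^2"
proof -
  let ?y = "cubic_param x"
  let ?A = "ball 0 1 :: complex set"
  note param = hauptmodul_conv_param
  have xb: "x \<in> ?A" "norm (x^3) < 1" using x norm_power_less_1[of x 3] by auto
  note chain = deriv_hauptmodul_chain[OF x(1)]
  have y': "deriv param_map ?y \<noteq> 0" "deriv cubic_param x \<noteq> 0"
    using deriv_hauptmodul_nonzero[OF x(1)] unfolding chain(1) by auto
  have param_map_cube': "deriv param_map_cube ?y \<noteq> 0"
    using deriv_hauptmodul_nonzero[OF xb(2)] chain(2) x(2) by auto
  have y: "?y \<noteq> 0"
    using hauptmodul_nonzero[OF x] unfolding param(1)[OF x(1)] by (auto simp: param_map_def)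
  have cube: "deriv (\<lambda>x. x^3) x = 3 * x^2"
    by (rule DERIV_imp_deriv) (auto intro!: derivative_eq_intros)
  have "schwarzian hauptmodul x = schwarzian (\<lambda>x. param_map (cubic_param x)) x"
    by (rule schwarzian_cong, rule eventually_mono[OF eventually_nhds_in_open[OF _ xb(1)]]) (auto simp: param)
  also have "\<dots> = schwarzian param_map ?y * deriv cubic_param x ^ 2 + schwarzian cubic_param x"
    by (rule schwarzian_compose[OF holomorphic_param_map holomorphic_cubic_param _ _ _ xb(1) y']) auto
  finally have 1: "schwarzian_defect x = schwarzian cubic_param x
      + (schwarzian param_map ?y + potential (param_map ?y) * deriv param_map ?y ^ 2) * deriv cubic_param x ^ 2"
    unfolding schwarzian_defect_def chain param(1)[OF x(1)] by (simp add: algebra_simps)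
  have "schwarzian (\<lambda>x. hauptmodul (x^3)) x
      = schwarzian hauptmodul (x^3) * deriv (\<lambda>x. x^3) x ^ 2 + schwarzian (\<lambda>x. x^3) x"
    by (rule schwarzian_compose[where A = ?A and B = ?A])
       (use x xb deriv_hauptmodul_nonzero[OF xb(2)] holomorphic_hauptmodul in
         \<open>auto simp: cube norm_power_less_1 intro!: holomorphic_intros\<close>)
  then have "schwarzian hauptmodul (x^3) * (3 * x^2)^2 - 4 / x^2 = schwarzian (\<lambda>x. hauptmodul (x^3)) x"
    unfolding cube schwarzian_cube[OF x(2)] by simp
  also have "\<dots> = schwarzian (\<lambda>x. param_map_cube (cubic_param x)) x"
    by (rule schwarzian_cong, rule eventually_mono[OF eventually_nhds_in_open[OF _ xb(1)]]) (auto simp: param)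
  also have "\<dots> = schwarzian param_map_cube ?y * deriv cubic_param x ^ 2 + schwarzian cubic_param x"
    by (rule schwarzian_compose[OF holomorphic_param_map_cube holomorphic_cubic_param _ open_param_map_cube_domain _ xb(1) param_map_cube' y'(2)])
       (auto simp: param(3))
  finally have "schwarzian hauptmodul (x^3) * (3 * x^2)^2 - 4 / x^2
      = schwarzian param_map_cube ?y * deriv cubic_param x ^ 2 + schwarzian cubic_param x" .
  moreover have "potential (hauptmodul (x^3)) * (deriv hauptmodul (x^3) * (3 * x^2))^2
      = potential (param_map_cube ?y) * deriv param_map_cube ?y ^ 2 * deriv cubic_param x ^ 2"
    unfolding chain(2) param(2)[OF x(1)] by (simp add: power_mult_distrib)
  ultimately have 2: "9 * x^4 * schwarzian_defect (x^3) - 4 / x^2 = schwarzian cubic_param x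
      + (schwarzian param_map_cube ?y + potential (param_map_cube ?y) * deriv param_map_cube ?y ^ 2) * deriv cubic_param x ^ 2"
    unfolding schwarzian_defect_def by (simp add: algebra_simps eval_nat_numeral)
  show ?thesis
    unfolding 1 2
    using param_maps_same_pullback[OF param(3)[OF x(1)] y] cubic_param_factors_nonzero[OF x(1)] by simp
qed

text \<open>
  The factor \<open>9^n\<close> is the square of the exponent \<open>3^n\<close>, so this is a subsequence of \<open>k^2 |x|^k\<close>.
\<close>
lemma power_vanish:
  assumes "norm (x::complex) < 1"
  shows "(\<lambda>n. 9^n * x ^ (3^n)) \<longlonglongrightarrow> 0"
proof -
  \<comment> \<open>Half of the decay is spent on each factor \<open>3^n\<close>.\<close>
  define r where "r = sqrt (norm x)"
  have r: "norm x = r^2" "0 \<le> r" "r < 1" using assms by (auto simp: r_def)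
  have "(\<lambda>n. real n * r ^ n) \<longlonglongrightarrow> 0"
    using powser_times_n_limit_0[of r] r by simp
  then have "(\<lambda>n. (real n * r ^ n)^2) \<longlonglongrightarrow> 0"
    by (auto intro: tendsto_eq_intros)
  then have "(\<lambda>n. (real (3^n) * r ^ (3^n))^2) \<longlonglongrightarrow> 0"
    by (rule filterlim_compose[OF _ filterlim_three_power])
  moreover have "(real (3^n) * r ^ (3^n))^2 = norm (9^n * x ^ (3^n))" for n
  proof -
    have "(3^n)^2 = (9::real)^n" by (simp add: power2_eq_square flip: power_mult_distrib)
    then show ?thesis
      by (simp add: norm_mult norm_power r power_mult_distrib flip: power_mult) (simp add: mult.commute)
  qed
  ultimately have "(\<lambda>n. norm (9^n * x ^ (3^n))) \<longlonglongrightarrow> 0"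
    by (simp only:)
  then show ?thesis
    by (rule tendsto_norm_zero_cancel)
qed

lemma schwarzian_defect_eq:
  assumes x: "norm x < 1" "x \<noteq> 0"
  shows "x^2 * schwarzian_defect x = 1 / 2"
proof -
  define V where "V x = (psi_minus (x^3) / psi_minus x) ^ 4" for x
  define N where "N u = 81 * u ^ 4 + 108 * u ^ 3 + 102 * u ^ 2 + 12 * u + 1" for u :: complex
  \<comment> \<open>The factor \<open>x^2\<close> cancels the double pole that the potential has at the zero of the hauptmodul,
      so this form of \<open>1/2 - x^2 * schwarzian_defect x\<close> is holomorphic at \<open>0\<close> as well.\<close>
  define H where "H x = 1/2 - x^2 * schwarzian hauptmodul x
      - deriv hauptmodul x ^ 2 * N (hauptmodul x)
        / (2 * V x ^ 2 * (hauptmodul x + 1)^2 * (9 * hauptmodul x + 1)^2)" for x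
  have "V holomorphic_on ball 0 1"
    unfolding V_def[abs_def]
    by (intro holomorphic_intros holomorphic_psi_minus_compose psi_minus_nonzero)
       (auto simp: norm_power_less_1)
  moreover have V: "V y \<noteq> 0" if "norm y < 1" for y
    using that by (simp add: V_def psi_minus_nonzero norm_power_less_1)
  ultimately have hol: "H holomorphic_on ball 0 1"
    unfolding H_def[abs_def] N_def
    by (intro holomorphic_intros holomorphic_schwarzian holomorphic_hauptmodul)
       (auto simp: deriv_hauptmodul_nonzero hauptmodul_omits)
  \<comment> \<open>The double pole has coefficient \<open>1/2\<close>, because \<open>V 0 = 1\<close> and the hauptmodul has derivative \<open>1\<close>.\<close>
  have H0: "H 0 = 0"
    by (simp add: H_def N_def V_def deriv_hauptmodul_0)
  have H: "H y = 1/2 - y^2 * schwarzian_defect y" if y: "norm y < 1" "y \<noteq> 0" for y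
  proof -
    have "hauptmodul y = y * V y" by (simp add: hauptmodul_def V_def)
    then have "y^2 * (potential (hauptmodul y) * deriv hauptmodul y ^ 2)
        = deriv hauptmodul y ^ 2 * N (hauptmodul y) / (2 * V y ^ 2 * (hauptmodul y + 1)^2 * (9 * hauptmodul y + 1)^2)"
      unfolding potential_def N_def[symmetric] using y by (simp add: power_mult_distrib mult_ac)
    then show ?thesis
      by (simp add: H_def schwarzian_defect_def algebra_simps)
  qed
  have step: "H y = 9 * H (y^3)" if y: "norm y < 1" "y \<noteq> 0" for y
  proof -
    have "H y = 1/2 - y^2 * (9 * y^4 * schwarzian_defect (y^3) - 4 / y^2)"
      using H[OF y] schwarzian_defect_cube[OF y] by simp
    also have "\<dots> = 9 * (1/2 - (y^3)^2 * schwarzian_defect (y^3))"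
      using y by (simp add: field_simps flip: power_mult power_add)
    also have "\<dots> = 9 * H (y^3)"
      using H[of "y^3"] y norm_power_less_1[of y 3] by simp
    finally show ?thesis .
  qed
  have n: "norm (x ^ (3^n)) < 1" "x ^ (3^n) \<noteq> 0" for n
    using x by (auto intro!: norm_power_less_1)
  have iter: "H x = 9^n * H (x ^ (3^n))" for n
  proof (induction n)
    case (Suc n)
    have "x ^ (3 ^ Suc n) = (x ^ (3^n))^3"
      by (simp flip: power_mult add: mult.commute)
    with Suc.IH step[OF n] show ?case by simp
  qed simp
  have "(H has_field_derivative deriv H 0) (at 0)"
    using holomorphic_derivI[OF hol, of 0] by simp
  then have "(\<lambda>y. H y / y) \<midarrow>0\<rightarrow> deriv H 0"
    by (simp add: DERIV_def H0)
  moreover have "filterlim (\<lambda>n. x ^ (3^n)) (at 0) sequentially"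
    using tendsto_power_three_power[OF x(1)] n(2) by (intro filterlim_atI) auto
  ultimately have "(\<lambda>n. H (x ^ (3^n)) / x ^ (3^n)) \<longlonglongrightarrow> deriv H 0"
    by (rule filterlim_compose)
  \<comment> \<open>The sequence on the left is constant, equal to \<open>H x\<close>.\<close>
  then have "(\<lambda>n. (9^n * x ^ (3^n)) * (H (x ^ (3^n)) / x ^ (3^n))) \<longlonglongrightarrow> 0 * deriv H 0"
    by (intro tendsto_mult power_vanish x)
  moreover have "(9^n * x ^ (3^n)) * (H (x ^ (3^n)) / x ^ (3^n)) = H x" for n
    using n(2) iter[of n] by simp
  ultimately have "H x = 0"
    by (simp add: LIMSEQ_const_iff)
  then show ?thesis using H[OF x] by simp
qed

section \<open>Back to the upper half-plane\<close>

lemma dedekind_eta_conv_euler_prod: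
  "dedekind_eta z = exp (2 * of_real pi * \<i> * z / 24) * euler_prod (exp (2 * of_real pi * \<i> * z))"
proof -
  have "exp (2 * of_real pi * \<i> * of_nat (Suc n) * z) = exp (2 * of_real pi * \<i> * z) ^ Suc n" for n
    by (simp only: exp_of_nat_mult[symmetric] mult_ac)
  then show ?thesis
    unfolding dedekind_eta_def euler_prod_def by (simp only:)
qed

lemma eta_quotient_conv_hauptmodul:
  assumes z: "z \<in> upper_half_plane"
  shows "(dedekind_eta z ^ 4 * dedekind_eta (3 * z / 2) ^ 4 * dedekind_eta (6 * z) ^ 4) /
            (dedekind_eta (z / 2) ^ 4 * dedekind_eta (2 * z) ^ 4 * dedekind_eta (3 * z) ^ 4)
     = hauptmodul (exp (\<i> * of_real pi * z))"
proof -
  define x where "x = exp (\<i> * of_real pi * z)"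
  \<comment> \<open>\<open>e a\<close> plays the part of \<open>x^(a/24)\<close>, with a definite branch.\<close>
  define e where "e a = exp (\<i> * of_real pi * z * of_real a / 24)" for a
  have e: "e a * e b = e (a + b)" "e a ^ 4 = e (4 * a)" "e a / e b = e (a - b)" for a b
    by (simp_all add: e_def algebra_simps add_divide_distrib diff_divide_distrib flip: exp_add exp_diff exp_of_nat_mult)
  have eta: "dedekind_eta z = e 2 * euler_prod (x^2)" "dedekind_eta (3 * z / 2) = e 3 * euler_prod (x^3)"
     "dedekind_eta (6 * z) = e 12 * euler_prod (x^12)" "dedekind_eta (z / 2) = e 1 * euler_prod x"
     "dedekind_eta (2 * z) = e 4 * euler_prod (x^4)" "dedekind_eta (3 * z) = e 6 * euler_prod (x^6)"
    unfolding dedekind_eta_conv_euler_prod x_def e_def exp_of_nat_mult[symmetric]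
    by (simp_all add: mult_ac)
  have "(e 2 ^ 4 * e 3 ^ 4 * e 12 ^ 4) / (e 1 ^ 4 * e 4 ^ 4 * e 6 ^ 4) = x"
    unfolding e by (simp add: e_def x_def mult_ac)
  moreover have "(euler_prod (x^2) ^ 4 * euler_prod (x^3) ^ 4 * euler_prod (x^12) ^ 4)
      / (euler_prod x ^ 4 * euler_prod (x^4) ^ 4 * euler_prod (x^6) ^ 4) = (psi_minus (x^3) / psi_minus x) ^ 4"
    unfolding psi_minus_def by (simp add: power_mult_distrib power_divide mult_ac flip: power_mult)
  moreover have "(a * p)^4 * (b * q)^4 * (c * r)^4 / ((a' * p')^4 * (b' * q')^4 * (c' * r')^4)
      = (a^4 * b^4 * c^4) / (a'^4 * b'^4 * c'^4) * ((p^4 * q^4 * r^4) / (p'^4 * q'^4 * r'^4))"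
    for a b c p q r a' b' c' p' q' r' :: complex
    by (simp add: power_mult_distrib mult_ac)
  ultimately show ?thesis
    unfolding eta hauptmodul_def x_def[symmetric] by (simp only:)
qed

theorem theorem11p1:
  fixes u :: "complex \<Rightarrow> complex" and \<tau> :: complex
  assumes u: "\<And>z. z \<in> upper_half_plane \<Longrightarrow>
      u z = (dedekind_eta z ^ 4 * dedekind_eta (3 * z / 2) ^ 4 * dedekind_eta (6 * z) ^ 4) /
            (dedekind_eta (z / 2) ^ 4 * dedekind_eta (2 * z) ^ 4 * dedekind_eta (3 * z) ^ 4)"
    and \<tau>: "\<tau> \<in> upper_half_plane"
  shows "schwarzian u \<tau> +
      (81 * u \<tau> ^ 4 + 108 * u \<tau> ^ 3 + 102 * u \<tau> ^ 2 + 12 * u \<tau> + 1) /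
      (2 * u \<tau> ^ 2 * (u \<tau> + 1) ^ 2 * (9 * u \<tau> + 1) ^ 2) * (deriv u \<tau>) ^ 2 = 0"
proof -
  define c where "c = \<i> * complex_of_real pi"
  define E where "E z = exp (c * z)" for z
  define x where "x = E \<tau>"
  have "c \<noteq> 0" by (simp add: c_def)
  have E1: "norm (E z) < 1" if "z \<in> upper_half_plane" for z
    using that by (simp add: E_def c_def upper_half_plane_def)
  have x: "norm x < 1" "x \<noteq> 0" using E1[OF \<tau>] by (simp_all add: x_def E_def)
  have op: "open upper_half_plane"
    unfolding upper_half_plane_def by (rule open_halfspace_Im_gt)
  have uE: "u z = hauptmodul (E z)" if "z \<in> upper_half_plane" for z
    using u[OF that] eta_quotient_conv_hauptmodul[OF that] by (simp add: E_def c_def)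
  have ev: "eventually (\<lambda>z. u z = hauptmodul (E z)) (nhds \<tau>)"
    using eventually_nhds_in_open[OF op \<tau>] by eventually_elim (rule uE)
  have hE: "E holomorphic_on upper_half_plane"
    unfolding E_def[abs_def] by (intro holomorphic_intros)
  have DE: "(E has_field_derivative c * x) (at \<tau>)"
    unfolding E_def[abs_def] x_def by (auto intro!: derivative_eq_intros)
  then have dE: "deriv E \<tau> = c * x" by (rule DERIV_imp_deriv)
  have "deriv u \<tau> = deriv (\<lambda>z. hauptmodul (E z)) \<tau>"
    by (rule deriv_cong_ev[OF ev refl])
  also have "\<dots> = deriv hauptmodul x * (c * x)"
    using holomorphic_derivI[OF holomorphic_hauptmodul, of x] x DE
    by (intro DERIV_imp_deriv DERIV_chain2[of hauptmodul]) (auto simp: x_def)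
  finally have du: "deriv u \<tau> = deriv hauptmodul x * (c * x)" .
  have "schwarzian u \<tau> = schwarzian (\<lambda>z. hauptmodul (E z)) \<tau>"
    by (rule schwarzian_cong[OF ev])
  also have "\<dots> = schwarzian hauptmodul x * (c * x)^2 + schwarzian E \<tau>"
    unfolding x_def dE[unfolded x_def, symmetric]
    using E1 deriv_hauptmodul_nonzero[OF x(1)] x \<open>c \<noteq> 0\<close> dE
    by (intro schwarzian_compose[OF holomorphic_hauptmodul hE op _ _ \<tau>]) (auto simp: x_def)
  also have "schwarzian E \<tau> = - (c^2) / 2"
    unfolding E_def[abs_def] by (rule schwarzian_exp) fact
  finally have su: "schwarzian u \<tau> = schwarzian hauptmodul x * (c * x)^2 - c^2 / 2" by simp
  have ux: "u \<tau> = hauptmodul x" using uE[OF \<tau>] by (simp add: x_def)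
  have "schwarzian u \<tau> + potential (u \<tau>) * deriv u \<tau> ^ 2 = c^2 * (x^2 * schwarzian_defect x - 1/2)"
    unfolding su ux du schwarzian_defect_def by (simp add: algebra_simps power_mult_distrib)
  also have "\<dots> = 0"
    using schwarzian_defect_eq[OF x] by simp
  finally show ?thesis
    by (simp add: potential_def)
qed

end
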